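(* Let $G$ be a connected graph of order $n\ge 3$ with $\gamma_{\rm R}(G)=\gamma(G)+1$. Then $b_{\rm R}(G)\le\min\{b(G),n_{\Delta}\}$, where $n_{\Delta}$ is the number of vertices of maximum degree $\Delta$ in $G$.
   Context: Graphs are finite, undirected, without loops or multiple edges; a graph is nonempty if it has at least one edge. $\gamma(G)$ is the domination number of $G$ (minimum cardinality of a vertex set $S$ such that every vertex is in $S$ or adjacent to a vertex of $S$). The bondage number $b(G)$ is the minimum number of edges whose removal from $G$ results in a graph with domination number larger than $\gamma(G)$. A Roman dominating function on $G=(V,E)$ is a function $f:V\to\{0,1,2\}$ such that every vertex $x$ with $f(x)=0$ is adjacent to at least one vertex $y$ with $f(y)=2$. Its weight is $\sum_{u\in V}f(u)$. The Roman domination number $\gamma_{\rm R}(G)$ is the minimum weight of a Roman dominating function on $G$. The Roman bondage number of a nonempty graph $G$ is $b_{\rm R}(G)=\min\{|B|: B\subseteq E(G),\ \gamma_{\rm R}(G-B)>\gamma_{\rm R}(G)\}$, with $b_{\rm R}(G)=\infty$ if no such $B$ exists; here $G-B$ is obtained from $G$ by deleting the edges in $B$ (keeping all vertices). *)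

theory Defs
  imports "HOL-Library.Extended_Nat"
begin

text \<open>
  A graph is given by its vertex set \<open>V\<close> and its edge set \<open>E\<close>; an edge is an unordered pair,
  that is, a two-element set of vertices. For \<open>B \<subseteq> E\<close>, the graph \<open>G - B\<close> is \<open>(V, E - B)\<close>.
\<close>

definition simple_graph :: "'a set \<Rightarrow> 'a set set \<Rightarrow> bool" where
  "simple_graph V E \<longleftrightarrow> finite V \<and> (\<forall>e\<in>E. e \<subseteq> V \<and> card e = 2)"

definition adjacent :: "'a set set \<Rightarrow> 'a \<Rightarrow> 'a \<Rightarrow> bool" where
  "adjacent E x y \<longleftrightarrow> {x, y} \<in> E"

definition connected_graph :: "'a set \<Rightarrow> 'a set set \<Rightarrow> bool" where
  "connected_graph V E \<longleftrightarrow> V \<noteq> {} \<and> (\<forall>x\<in>V. \<forall>y\<in>V. (adjacent E)\<^sup>*\<^sup>* x y)"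

definition degree :: "'a set set \<Rightarrow> 'a \<Rightarrow> nat" where
  "degree E v = card {e \<in> E. v \<in> e}"

definition max_degree :: "'a set \<Rightarrow> 'a set set \<Rightarrow> nat" where
  "max_degree V E = Max (degree E ` V)"

definition num_max_degree :: "'a set \<Rightarrow> 'a set set \<Rightarrow> nat" where
  "num_max_degree V E = card {v \<in> V. degree E v = max_degree V E}"

definition dominating_set :: "'a set \<Rightarrow> 'a set set \<Rightarrow> 'a set \<Rightarrow> bool" where
  "dominating_set V E S \<longleftrightarrow> S \<subseteq> V \<and> (\<forall>x\<in>V. x \<in> S \<or> (\<exists>y\<in>S. adjacent E x y))"

definition domination_number :: "'a set \<Rightarrow> 'a set set \<Rightarrow> nat" where
  "domination_number V E = (LEAST k. \<exists>S. dominating_set V E S \<and> card S = k)"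

text \<open>
  Only the values of \<open>f\<close> on \<open>V\<close> matter; \<open>f\<close> is unconstrained elsewhere.
\<close>

definition roman_dominating_function :: "'a set \<Rightarrow> 'a set set \<Rightarrow> ('a \<Rightarrow> nat) \<Rightarrow> bool" where
  "roman_dominating_function V E f \<longleftrightarrow>
     (\<forall>x\<in>V. f x \<in> {0, 1, 2}) \<and>
     (\<forall>x\<in>V. f x = 0 \<longrightarrow> (\<exists>y\<in>V. adjacent E x y \<and> f y = 2))"

definition roman_domination_number :: "'a set \<Rightarrow> 'a set set \<Rightarrow> nat" where
  "roman_domination_number V E =
     (LEAST k. \<exists>f. roman_dominating_function V E f \<and> (\<Sum>u\<in>V. f u) = k)"

text \<open>
  The infimum of the empty set in \<^typ>\<open>enat\<close> is \<open>\<infinity>\<close>, which is the convention for the Roman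
  bondage number when no suitable \<open>B\<close> exists. The bondage number of a graph with at least one
  edge is always finite, since deleting all edges increases the domination number.
\<close>

definition bondage_number :: "'a set \<Rightarrow> 'a set set \<Rightarrow> enat" where
  "bondage_number V E =
     (INF B \<in> {B. B \<subseteq> E \<and> domination_number V (E - B) > domination_number V E}.
        enat (card B))"

definition roman_bondage_number :: "'a set \<Rightarrow> 'a set set \<Rightarrow> enat" where
  "roman_bondage_number V E =
     (INF B \<in> {B. B \<subseteq> E \<and> roman_domination_number V (E - B) > roman_domination_number V E}.
        enat (card B))"

end

theory Submission
  imports Defs
begin

text \<open>
  The weight of a Roman dominating function \<open>f\<close> is the size of its support \<open>P\<close> plus the number
  of vertices of value 2, and \<open>P\<close> is a dominating set. If the weight is at most
  \<open>\<gamma> + 1\<close>, where \<open>\<gamma>\<close> is the domination number, then at most one vertex has value 2.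
  The case of no such vertex is impossible for a weight below \<open>n\<close>, because then \<open>f\<close> is nonzero
  everywhere. A connected graph of order \<open>n \<ge> 3\<close> has a vertex of degree at least 2, and
  giving value 2 to a vertex \<open>v\<close>, 0 to its neighbours and 1 to the rest shows
  \<open>\<gamma>\<^sub>R \<le> n + 1 - deg v\<close>; so the Roman domination number \<open>\<gamma>\<^sub>R\<close> is below \<open>n\<close>, and
  \<open>\<Delta> \<le> n - \<gamma>\<close> once \<open>\<gamma>\<^sub>R = \<gamma> + 1\<close>.

  If deleting \<open>B\<close> raises the domination number, a Roman dominating function of \<open>G - B\<close> has a
  support of at least \<open>\<gamma> + 1 = \<gamma>\<^sub>R\<close> vertices. It can have weight at most \<open>\<gamma>\<^sub>R\<close> only
  without the value 2, which is impossible; hence \<open>B\<close> raises the Roman domination number too.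

  If \<open>B\<close> contains an edge at each vertex of maximum degree, all degrees of \<open>G - B\<close> are below
  \<open>\<Delta>\<close>. A Roman dominating function of \<open>G - B\<close> of weight at most \<open>\<gamma> + 1\<close> would have
  exactly one vertex of value 2, adjacent in \<open>G - B\<close> to all the at least \<open>n - \<gamma> \<ge> \<Delta>\<close>
  vertices of value 0. This is absurd, and such a \<open>B\<close> exists with at most \<open>n\<^sub>\<Delta>\<close> edges.
\<close>

section \<open>Degrees\<close>

lemma adjacent_sym: "adjacent E x y \<longleftrightarrow> adjacent E y x"
  by (simp add: adjacent_def insert_commute)

lemma simple_graph_finite_edges:
  assumes "simple_graph V E"
  shows "finite E"
proof (rule finite_subset)
  show "E \<subseteq> Pow V" "finite (Pow V)"
    using assms by (auto simp: simple_graph_def)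
qed

lemma simple_graph_Diff: "simple_graph V E \<Longrightarrow> simple_graph V (E - B)"
  by (auto simp: simple_graph_def)

lemma simple_graph_adjacentD:
  assumes "simple_graph V E" "adjacent E x y"
  shows "x \<in> V" "y \<in> V" "x \<noteq> y"
proof -
  have "{x, y} \<subseteq> V" "card {x, y} = 2"
    using assms by (auto simp: simple_graph_def adjacent_def)
  then show "x \<in> V" "y \<in> V" "x \<noteq> y"
    by auto
qed

lemma degree_eq_card_neighbours:
  assumes "simple_graph V E"
  shows "degree E v = card {u. adjacent E v u}"
proof -
  have "bij_betw (\<lambda>u. {v, u}) {u. adjacent E v u} {e \<in> E. v \<in> e}"
  proof (rule bij_betwI')
    fix x y
    show "({v, x} = {v, y}) = (x = y)"
      by (auto simp: doubleton_eq_iff)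
  next
    fix x assume "x \<in> {u. adjacent E v u}"
    then show "{v, x} \<in> {e \<in> E. v \<in> e}"
      by (simp add: adjacent_def)
  next
    fix e assume e: "e \<in> {e \<in> E. v \<in> e}"
    then have "card e = 2"
      using assms by (auto simp: simple_graph_def)
    then obtain a b where "e = {a, b}"
      by (auto simp: card_2_iff)
    with e show "\<exists>x\<in>{u. adjacent E v u}. e = {v, x}"
      by (auto simp: adjacent_def insert_commute)
  qed
  then show ?thesis
    by (simp add: degree_def bij_betw_same_card)
qed

lemma degree_le_max_degree:
  "simple_graph V E \<Longrightarrow> v \<in> V \<Longrightarrow> degree E v \<le> max_degree V E"
  by (simp add: simple_graph_def max_degree_def)

text \<open>
  If all degrees were at most 1, two adjacent vertices would form a whole component, which
  leaves no room for a third vertex.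
\<close>

lemma connected_graph_degree_ge_2:
  assumes G: "simple_graph V E" and conn: "connected_graph V E" and n: "card V \<ge> 3"
  obtains v where "v \<in> V" "degree E v \<ge> 2"
proof (rule ccontr)
  assume "\<not> thesis"
  then have small: "degree E v \<le> 1" if "v \<in> V" for v
    using that \<open>\<And>v. \<lbrakk>v \<in> V; 2 \<le> degree E v\<rbrakk> \<Longrightarrow> thesis\<close> by force
  have fin: "finite V"
    using G by (simp add: simple_graph_def)
  have uniq: "a = b" if "adjacent E v a" "adjacent E v b" for v a b
  proof -
    have "v \<in> V"
      using simple_graph_adjacentD[OF G that(1)] by simp
    then have "card {u. adjacent E v u} \<le> 1"
      using small[of v] degree_eq_card_neighbours[OF G, of v] by linarith
    moreover have "finite {u. adjacent E v u}"
      using fin by (rule finite_subset[rotated]) (use simple_graph_adjacentD[OF G] in auto)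
    ultimately show ?thesis
      using that by (auto simp: card_le_Suc0_iff_eq)
  qed
  obtain x where x: "x \<in> V"
    using conn by (auto simp: connected_graph_def)
  have beyond: "\<exists>z\<in>V. z \<notin> {x, y}" for y
  proof (rule ccontr)
    assume "\<not> ?thesis"
    then have "card V \<le> card {x, y}"
      by (intro card_mono) auto
    also have "\<dots> \<le> 2"
      by (simp add: card_insert_if)
    finally show False
      using n by simp
  qed
  obtain z where "z \<in> V" "z \<noteq> x"
    using beyond[of x] by auto
  then have "(adjacent E)\<^sup>*\<^sup>* x z"
    using conn x by (simp add: connected_graph_def)
  with \<open>z \<noteq> x\<close> obtain y where y: "adjacent E x y"
    by (metis converse_rtranclpE)
  obtain w where w: "w \<in> V" "w \<notin> {x, y}"
    using beyond[of y] by auto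
  have "u \<in> {x, y}" if "(adjacent E)\<^sup>*\<^sup>* x u" for u
    using that
  proof induction
    case (step a b)
    then show ?case
      using uniq y adjacent_sym[of E x y] by blast
  qed simp
  moreover have "(adjacent E)\<^sup>*\<^sup>* x w"
    using conn x w by (simp add: connected_graph_def)
  ultimately show False
    using w by blast
qed

text \<open>
  One incident edge per vertex of maximum degree suffices; an edge chosen at both of its ends
  only makes \<open>B\<close> smaller.
\<close>

lemma lower_all_degrees:
  assumes G: "simple_graph V E" and pos: "max_degree V E > 0"
  obtains B where "B \<subseteq> E" "card B \<le> num_max_degree V E"
    "\<And>v. v \<in> V \<Longrightarrow> degree (E - B) v < max_degree V E"
proof -
  define M where "M = {v \<in> V. degree E v = max_degree V E}"
  have "finite M"
    using G by (simp add: M_def simple_graph_def)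
  have "\<exists>e. e \<in> E \<and> v \<in> e" if "v \<in> M" for v
  proof -
    have "card {e \<in> E. v \<in> e} > 0"
      using that pos by (simp add: M_def degree_def)
    then show ?thesis
      by (metis (mono_tags, lifting) card_gt_0_iff empty_Collect_eq)
  qed
  then obtain e where e: "\<And>v. v \<in> M \<Longrightarrow> e v \<in> E \<and> v \<in> e v"
    by metis
  show thesis
  proof
    show "e ` M \<subseteq> E"
      using e by auto
    show "card (e ` M) \<le> num_max_degree V E"
      using card_image_le[OF \<open>finite M\<close>] by (simp add: num_max_degree_def M_def)
    fix v assume v: "v \<in> V"
    have finE: "finite {d \<in> E. v \<in> d}"
      using simple_graph_finite_edges[OF G] by simp
    show "degree (E - e ` M) v < max_degree V E"
    proof (cases "v \<in> M")
      case True
      have "{d \<in> E - e ` M. v \<in> d} \<subset> {d \<in> E. v \<in> d}"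
        using e[OF True] True by auto
      then have "degree (E - e ` M) v < degree E v"
        unfolding degree_def by (rule psubset_card_mono[OF finE])
      with True show ?thesis
        by (simp add: M_def)
    next
      case False
      have "degree (E - e ` M) v \<le> degree E v"
        unfolding degree_def by (rule card_mono[OF finE]) auto
      also have "\<dots> < max_degree V E"
        using False v degree_le_max_degree[OF G v] by (simp add: M_def)
      finally show ?thesis .
    qed
  qed
qed

section \<open>Roman dominating functions\<close>

lemma roman_domination_number_le:
  "roman_dominating_function V E f \<Longrightarrow> roman_domination_number V E \<le> (\<Sum>u\<in>V. f u)"
  unfolding roman_domination_number_def by (rule Least_le) blast

lemma roman_domination_number_attained:
  obtains f where "roman_dominating_function V E f" "(\<Sum>u\<in>V. f u) = roman_domination_number V E"
proof -
  have "roman_dominating_function V E (\<lambda>_. 1)"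
    by (simp add: roman_dominating_function_def)
  then have "\<exists>k f. roman_dominating_function V E f \<and> (\<Sum>u\<in>V. f u) = k"
    by blast
  then have "\<exists>f. roman_dominating_function V E f \<and> (\<Sum>u\<in>V. f u) = roman_domination_number V E"
    unfolding roman_domination_number_def by (rule LeastI_ex)
  then show thesis
    using that by blast
qed

lemma roman_weight_eq:
  assumes "finite V" "roman_dominating_function V E f"
  shows "(\<Sum>u\<in>V. f u) = card {x \<in> V. f x \<noteq> 0} + card {x \<in> V. f x = 2}"
proof -
  have "(\<Sum>u\<in>V. f u) = (\<Sum>u\<in>V. (if f u \<noteq> 0 then 1 else 0) + (if f u = 2 then 1 else 0))"
    by (rule sum.cong) (use assms in \<open>auto simp: roman_dominating_function_def\<close>)
  also have "\<dots> = card {x \<in> V. f x \<noteq> 0} + card {x \<in> V. f x = 2}"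
    using assms(1) by (simp add: sum.distrib sum.If_cases Int_def)
  finally show ?thesis .
qed

lemma domination_number_le_card_roman_support:
  assumes "roman_dominating_function V E f"
  shows "domination_number V E \<le> card {x \<in> V. f x \<noteq> 0}"
proof -
  have "dominating_set V E {x \<in> V. f x \<noteq> 0}"
    using assms by (fastforce simp: roman_dominating_function_def dominating_set_def)
  then show ?thesis
    unfolding domination_number_def by (intro Least_le) blast
qed

lemma domination_number_mono_Diff:
  "domination_number V E \<le> domination_number V (E - B)"
proof -
  have "dominating_set V (E - B) V"
    by (simp add: dominating_set_def)
  then have "\<exists>k S. dominating_set V (E - B) S \<and> card S = k"
    by blast
  then have "\<exists>S. dominating_set V (E - B) S \<and> card S = domination_number V (E - B)"
    unfolding domination_number_def by (rule LeastI_ex)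
  then obtain S where S: "dominating_set V (E - B) S" "card S = domination_number V (E - B)"
    by blast
  have "dominating_set V E S"
    using S(1) by (auto simp: dominating_set_def adjacent_def)
  then have "domination_number V E \<le> card S"
    unfolding domination_number_def by (intro Least_le) blast
  with S(2) show ?thesis
    by simp
qed

text \<open>
  Starting from the constant function 1, one extra unit at \<open>v\<close> saves one unit at each
  neighbour of \<open>v\<close>.
\<close>

lemma roman_domination_number_add_degree_le:
  assumes G: "simple_graph V E" and v: "v \<in> V"
  shows "roman_domination_number V E + degree E v \<le> card V + 1"
proof -
  define N where "N = {u. adjacent E v u}"
  define f :: "'a \<Rightarrow> nat" where "f x = (if x = v then 2 else if x \<in> N then 0 else 1)" for x
  have fin: "finite V"
    using G by (simp add: simple_graph_def)
  have N: "N \<subseteq> V" "v \<notin> N"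
    using simple_graph_adjacentD(2,3)[OF G] by (auto simp: N_def)
  have f: "roman_dominating_function V E f"
    using v by (auto simp: roman_dominating_function_def f_def N_def adjacent_sym)
  have "{x \<in> V. f x \<noteq> 0} = V - N" "{x \<in> V. f x = 2} = {v}"
    using v N by (auto simp: f_def)
  then have "(\<Sum>u\<in>V. f u) = card (V - N) + 1"
    using roman_weight_eq[OF fin f] by simp
  moreover have "card (V - N) + card N = card V"
    using N(1) fin by (metis card_Diff_subset card_mono finite_subset le_add_diff_inverse2)
  moreover have "degree E v = card N"
    using degree_eq_card_neighbours[OF G] by (simp add: N_def)
  ultimately show ?thesis
    using roman_domination_number_le[OF f] by simp
qed

lemma roman_weight_without_2:
  assumes "finite V" "roman_dominating_function V E f" "{x \<in> V. f x = 2} = {}"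
  shows "(\<Sum>u\<in>V. f u) = card V"
proof -
  have "{x \<in> V. f x \<noteq> 0} = V"
    using assms(2,3) by (auto simp: roman_dominating_function_def)
  then show ?thesis
    using roman_weight_eq[OF assms(1,2)] assms(3) by simp
qed

text \<open>
  Every vertex of value 0 must be a neighbour of the only vertex of value 2.
\<close>

lemma card_le_support_add_degree:
  assumes G: "simple_graph V E" and f: "roman_dominating_function V E f"
    and w: "{x \<in> V. f x = 2} = {w}"
  shows "card V \<le> card {x \<in> V. f x \<noteq> 0} + degree E w"
proof -
  have fin: "finite V"
    using G by (simp add: simple_graph_def)
  have "adjacent E w x" if x: "x \<in> V" "f x = 0" for x
  proof -
    obtain y where "y \<in> V" "adjacent E x y" "f y = 2"
      using f x by (auto simp: roman_dominating_function_def)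
    then show ?thesis
      using w by (auto simp: adjacent_sym)
  qed
  then have "V \<subseteq> {x \<in> V. f x \<noteq> 0} \<union> {u. adjacent E w u}"
    by auto
  moreover have "finite {u. adjacent E w u}"
    using fin by (rule finite_subset[rotated]) (use simple_graph_adjacentD[OF G] in auto)
  ultimately have "card V \<le> card ({x \<in> V. f x \<noteq> 0} \<union> {u. adjacent E w u})"
    using fin by (intro card_mono) auto
  also have "\<dots> \<le> card {x \<in> V. f x \<noteq> 0} + card {u. adjacent E w u}"
    by (rule card_Un_le)
  finally show ?thesis
    using degree_eq_card_neighbours[OF G] by simp
qed

section \<open>Edge sets that raise the Roman domination number\<close>

text \<open>
  The support alone already accounts for \<open>\<gamma> + 1 = \<gamma>\<^sub>R\<close> units of weight, so any vertex of
  value 2 pushes the weight above \<open>\<gamma>\<^sub>R\<close>.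
\<close>

lemma roman_domination_number_less_if_domination_number_less:
  assumes fin: "finite V"
    and small: "roman_domination_number V E < card V"
    and eq: "roman_domination_number V E = domination_number V E + 1"
    and B: "domination_number V E < domination_number V (E - B)"
  shows "roman_domination_number V E < roman_domination_number V (E - B)"
proof -
  obtain f where f: "roman_dominating_function V (E - B) f"
    and wt: "(\<Sum>u\<in>V. f u) = roman_domination_number V (E - B)"
    by (rule roman_domination_number_attained)
  have supp: "domination_number V (E - B) \<le> card {x \<in> V. f x \<noteq> 0}"
    using f by (rule domination_number_le_card_roman_support)
  show ?thesis
  proof (cases "{x \<in> V. f x = 2} = {}")
    case True
    then show ?thesis
      using roman_weight_without_2[OF fin f] wt small by simp
  next
    case False
    then have "card {x \<in> V. f x = 2} > 0"
      using fin by (simp add: card_gt_0_iff)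
    then show ?thesis
      using roman_weight_eq[OF fin f] wt supp eq B by linarith
  qed
qed

text \<open>
  Not raising \<open>\<gamma>\<^sub>R\<close> would leave a single vertex of value 2 to serve at least
  \<open>n - \<gamma> \<ge> \<Delta>\<close> vertices of value 0, more than its reduced degree.
\<close>

lemma roman_domination_number_less_if_degrees_less:
  assumes G: "simple_graph V E"
    and small: "roman_domination_number V E < card V"
    and eq: "roman_domination_number V E = domination_number V E + 1"
    and B: "\<And>v. v \<in> V \<Longrightarrow> degree (E - B) v < max_degree V E"
  shows "roman_domination_number V E < roman_domination_number V (E - B)"
proof (rule ccontr)
  assume neg: "\<not> ?thesis"
  have fin: "finite V"
    using G by (simp add: simple_graph_def)
  obtain f where f: "roman_dominating_function V (E - B) f"
    and wt: "(\<Sum>u\<in>V. f u) = roman_domination_number V (E - B)"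
    by (rule roman_domination_number_attained)
  have supp: "domination_number V E \<le> card {x \<in> V. f x \<noteq> 0}"
    using domination_number_mono_Diff domination_number_le_card_roman_support[OF f]
    by (rule order_trans)
  have weight: "card {x \<in> V. f x \<noteq> 0} + card {x \<in> V. f x = 2} \<le> domination_number V E + 1"
    using neg wt roman_weight_eq[OF fin f] eq by linarith
  have "{x \<in> V. f x = 2} \<noteq> {}"
    using roman_weight_without_2[OF fin f] wt small neg by auto
  then have "card {x \<in> V. f x = 2} > 0"
    using fin by (simp add: card_gt_0_iff)
  then have one: "card {x \<in> V. f x = 2} = 1"
    using weight supp by linarith
  then obtain w where w: "{x \<in> V. f x = 2} = {w}"
    by (rule card_1_singletonE)
  then have "w \<in> V"
    by auto
  then have "max_degree V E \<in> degree E ` V"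
    unfolding max_degree_def using fin by (intro Max_in) auto
  then obtain v where v: "v \<in> V" "degree E v = max_degree V E"
    by auto
  have "card V \<le> card {x \<in> V. f x \<noteq> 0} + degree (E - B) w"
    using card_le_support_add_degree[OF simple_graph_Diff[OF G] f w] .
  also have "\<dots> \<le> domination_number V E + degree (E - B) w"
    using weight one by simp
  also have "\<dots> < domination_number V E + max_degree V E"
    using B[OF \<open>w \<in> V\<close>] by simp
  also have "\<dots> \<le> card V"
    using roman_domination_number_add_degree_le[OF G v(1)] v(2) eq by simp
  finally show False
    by simp
qed

lemma roman_bondage_number_le:
  assumes "B \<subseteq> E" "roman_domination_number V E < roman_domination_number V (E - B)"
  shows "roman_bondage_number V E \<le> enat (card B)"
  unfolding roman_bondage_number_def by (rule INF_lower) (use assms in simp)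

theorem theorem5p3:
  fixes V :: "'a set" and E :: "'a set set"
  assumes "simple_graph V E"
    and "connected_graph V E"
    and "card V \<ge> 3"
    and "roman_domination_number V E = domination_number V E + 1"
  shows "roman_bondage_number V E \<le> min (bondage_number V E) (enat (num_max_degree V E))"
proof -
  note G = assms(1) and eq = assms(4)
  have fin: "finite V"
    using G by (simp add: simple_graph_def)
  obtain v where v: "v \<in> V" "degree E v \<ge> 2"
    using assms(1-3) by (rule connected_graph_degree_ge_2)
  have small: "roman_domination_number V E < card V"
    using roman_domination_number_add_degree_le[OF G v(1)] v(2) by linarith
  have "roman_bondage_number V E \<le> bondage_number V E"
    unfolding bondage_number_def
  proof (rule INF_greatest)
    fix B assume "B \<in> {B. B \<subseteq> E \<and> domination_number V E < domination_number V (E - B)}"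
    then show "roman_bondage_number V E \<le> enat (card B)"
      using roman_domination_number_less_if_domination_number_less[OF fin small eq]
      by (simp add: roman_bondage_number_le)
  qed
  moreover have "roman_bondage_number V E \<le> enat (num_max_degree V E)"
  proof -
    have "max_degree V E > 0"
      using degree_le_max_degree[OF G v(1)] v(2) by linarith
    then obtain B where B: "B \<subseteq> E" "card B \<le> num_max_degree V E"
      "\<And>v. v \<in> V \<Longrightarrow> degree (E - B) v < max_degree V E"
      using lower_all_degrees[OF G] by blast
    have "roman_bondage_number V E \<le> enat (card B)"
      using B(1) roman_domination_number_less_if_degrees_less[OF G small eq B(3)]
      by (rule roman_bondage_number_le)
    also have "\<dots> \<le> enat (num_max_degree V E)"
      using B(2) by simp
    finally show ?thesis .
  qed
  ultimately show ?thesis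
    by simp
qed

end
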